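(* Let $\mathbf{X}=(X_1,X_2,X_3)$ be a vector of independent and identically distributed random variables. Then $X_1$ has a mean zero Gaussian distribution if and only if for $V$ uniform on $(-1,1)$ and independent of $\mathbf{X}$, $$X_1 \stackrel{d}{=} V\sqrt{X_1^2+X_2^2+X_3^2}.$$
   Context: Random variables are real-valued, and $\stackrel{d}{=}$ denotes equality in distribution of two random variables. *)

theory Defs
  imports "HOL-Probability.Probability"
begin

text \<open>The Gaussian law with mean \<open>m\<close> and standard deviation \<open>s \<ge> 0\<close>. The degenerate case
  \<open>s = 0\<close> is the point mass at \<open>m\<close>; it needs a separate clause because the normal density
  of the library is the zero function for \<open>s = 0\<close>.\<close>

definition gaussian_law :: "real \<Rightarrow> real \<Rightarrow> real measure" where
  "gaussian_law m s =
     (if s = 0 then return borel m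
      else density lborel (\<lambda>x. ennreal (normal_density m s x)))"

definition mean_zero_gaussian :: "real measure \<Rightarrow> bool" where
  "mean_zero_gaussian \<mu> \<longleftrightarrow> (\<exists>s\<ge>0. \<mu> = gaussian_law 0 s)"

text \<open>The library's \<open>indep_var\<close> requires both random variables to have the same value type;
  this is the same notion (independence of the generated sigma-algebras) for two value types.\<close>

definition indep_random_variables ::
    "'a measure \<Rightarrow> 'b measure \<Rightarrow> ('a \<Rightarrow> 'b) \<Rightarrow> 'c measure \<Rightarrow> ('a \<Rightarrow> 'c) \<Rightarrow> bool" where
  "indep_random_variables M S Y T Z \<longleftrightarrow>
     Y \<in> measurable M S \<and> Z \<in> measurable M T \<and>
     prob_space.indep_set M {Y -` A \<inter> space M | A. A \<in> sets S} {Z -` B \<inter> space M | B. B \<in> sets T}"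

end

theory Submission
  imports Defs
begin

text \<open>Let \<open>\<mu>\<close> be the law of \<open>X\<^sub>1\<close> and \<open>R = sqrt (X\<^sub>1\<^sup>2 + X\<^sub>2\<^sup>2 + X\<^sub>3\<^sup>2)\<close>. No moments are assumed, so the
  argument rests on a transform that always exists, \<open>K r = E exp (- r\<^sup>2 X\<^sub>1\<^sup>2)\<close>, the Laplace
  transform of the law of \<open>X\<^sub>1\<^sup>2\<close> at \<open>r\<^sup>2\<close>. It suits this problem for two reasons. By independence
  it turns \<open>R\<^sup>2\<close> into a cube, \<open>E exp (- r\<^sup>2 R\<^sup>2) = K r ^ 3\<close>. And scaling by the uniform variable
  becomes averaging over the argument, so that the transform of \<open>V R\<close> at \<open>r > 0\<close> is
  \<open>(1 / r) \<integral>\<^sub>0\<^sup>r K s ^ 3 ds\<close> (\<open>law_of_uniform_scale\<close>).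

  The law of \<open>V R\<close> is symmetric because that of \<open>V\<close> is, and a symmetric law is determined by
  its transform (\<open>symmetric_law_eqI\<close>). Hence \<open>X\<^sub>1\<close> and \<open>V R\<close> are equal in law exactly when \<open>\<mu>\<close> is
  symmetric and \<open>r K r = \<integral>\<^sub>0\<^sup>r K s ^ 3 ds\<close> for all \<open>r > 0\<close>. Differentiating, \<open>G r = r K r\<close> solves the
  separable equation \<open>G' = G ^ 3 / r ^ 3\<close>, so \<open>1 / G\<^sup>2 - 1 / r\<^sup>2\<close> is a constant \<open>c\<close>, that is,
  \<open>K r = 1 / sqrt (1 + c r\<^sup>2)\<close> (\<open>averaged_cube_equation\<close>); conversely these functions solve the
  equation (\<open>integral_cubed_profile\<close>). They are the transforms of the centred Gaussian
  laws of variance \<open>c / 2\<close> (\<open>gauss_transform_gaussian_law\<close>), with \<open>c = 0\<close> for the point mass at 0,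
  and both implications follow.\<close>

section \<open>The Laplace transform of the squared variable\<close>

text \<open>The Laplace transform of the law of \<open>x\<^sup>2\<close> under \<open>\<mu>\<close>, at \<open>r\<^sup>2\<close>. The argument is taken as \<open>r\<close> rather
  than \<open>r\<^sup>2\<close> so that rescaling the variable by \<open>v\<close> replaces \<open>r\<close> by \<open>r v\<close>.\<close>

definition gauss_transform :: "real measure \<Rightarrow> real \<Rightarrow> real" where
  "gauss_transform \<mu> r = (\<integral>x. exp (- (r\<^sup>2 * x\<^sup>2)) \<partial>\<mu>)"

lemma gauss_transform_even: "gauss_transform \<mu> (- r) = gauss_transform \<mu> r"
  by (simp add: gauss_transform_def)

context real_distribution
begin

lemma integrable_gauss_kernel: "integrable M (\<lambda>x. exp (- (r\<^sup>2 * x\<^sup>2)))"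
  by (rule integrable_const_bound[where B = 1]) (auto intro!: mult_nonneg_nonneg)

lemma gauss_transform_le_1: "gauss_transform M r \<le> 1"
  unfolding gauss_transform_def
  by (rule integral_le_const[OF integrable_gauss_kernel]) auto

lemma gauss_transform_pos: "0 < gauss_transform M r"
proof -
  have "gauss_transform M r \<noteq> 0"
  proof
    assume "gauss_transform M r = 0"
    then have "AE x in M. exp (- (r\<^sup>2 * x\<^sup>2)) = 0"
      unfolding gauss_transform_def
      by (subst (asm) integral_nonneg_eq_0_iff_AE[OF integrable_gauss_kernel]) auto
    then show False by simp
  qed
  moreover have "gauss_transform M r \<ge> 0"
    unfolding gauss_transform_def by (rule integral_nonneg_AE) auto
  ultimately show ?thesis by simp
qed

lemma isCont_gauss_transform: "isCont (gauss_transform M) r"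
proof -
  have "((\<lambda>s. \<integral>x. exp (- (s\<^sup>2 * x\<^sup>2)) \<partial>M) \<longlongrightarrow> (\<integral>x. exp (- (r\<^sup>2 * x\<^sup>2)) \<partial>M)) (at r)"
    unfolding tendsto_at_iff_sequentially comp_def
  proof (intro allI impI)
    fix S assume S: "S \<longlonglongrightarrow> r"
    show "(\<lambda>i. \<integral>x. exp (- ((S i)\<^sup>2 * x\<^sup>2)) \<partial>M) \<longlonglongrightarrow> (\<integral>x. exp (- (r\<^sup>2 * x\<^sup>2)) \<partial>M)"
      by (rule integral_dominated_convergence[where w = "\<lambda>_. 1"])
         (auto intro!: tendsto_intros S)
  qed
  then show ?thesis by (simp add: isCont_def gauss_transform_def[abs_def])
qed

end

section \<open>Symmetric laws are determined by the transform\<close>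

text \<open>On \<open>[-1, 1]\<close> all moments are bounded by 1, so the Taylor polynomials of the characteristic
  function, whose coefficients are moments, converge to it on the whole real line.\<close>

lemma bounded_law_eq_if_moments_eq:
  assumes "real_distribution M" "real_distribution N"
    and bM: "AE x in M. \<bar>x\<bar> \<le> 1" and bN: "AE x in N. \<bar>x\<bar> \<le> 1"
    and mom: "\<And>k::nat. (\<integral>x. x ^ k \<partial>M) = (\<integral>x. x ^ k \<partial>N)"
  shows "M = N"
proof (rule Levy_uniqueness[OF assms(1,2)], rule ext)
  fix t :: real
  interpret M: real_distribution M by fact
  interpret N: real_distribution N by fact
  define p where "p n = (\<Sum>k\<le>n. ((\<i> * t)^k / fact k) * M.expectation (\<lambda>x. x^k))" for n
  have lim: "p \<longlonglongrightarrow> char L t"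
    if L: "real_distribution L" and b: "AE x in L. \<bar>x\<bar> \<le> 1"
      and m: "\<And>k::nat. (\<integral>x. x ^ k \<partial>M) = (\<integral>x. x ^ k \<partial>L)" for L
  proof -
    interpret L: real_distribution L by fact
    have int: "integrable L (\<lambda>x. x ^ k)" for k :: nat
      using b by (intro L.integrable_const_bound[where B = 1])
        (auto elim!: eventually_mono simp: power_abs power_le_one)
    have int': "integrable L (\<lambda>x. \<bar>x\<bar> ^ k)" for k :: nat
      using b by (intro L.integrable_const_bound[where B = 1])
        (auto elim!: eventually_mono simp: power_le_one)
    have le1: "L.expectation (\<lambda>x. \<bar>x\<bar> ^ k) \<le> 1" for k :: nat
      using b by (intro L.integral_le_const int') (auto elim!: eventually_mono simp: power_le_one)
    have bound: "norm (p n - char L t) \<le> 2 * (\<bar>t\<bar> ^ n / fact n)" for n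
    proof -
      have "norm (p n - char L t) \<le> (2*\<bar>t\<bar>^n / fact n) * L.expectation (\<lambda>x. \<bar>x\<bar>^n)"
        using L.char_approx1[of n t, OF int] by (simp add: p_def m norm_minus_commute)
      also have "\<dots> \<le> (2*\<bar>t\<bar>^n / fact n) * 1"
        by (intro mult_left_mono le1) auto
      finally show ?thesis by simp
    qed
    have pw: "summable (\<lambda>n. \<bar>t\<bar> ^ n / fact n)"
      using summable_exp[of "\<bar>t\<bar>"] by (simp add: field_simps)
    have "(\<lambda>n. 2 * (\<bar>t\<bar> ^ n / fact n)) \<longlonglongrightarrow> 2 * 0"
      by (intro tendsto_mult tendsto_const summable_LIMSEQ_zero[OF pw])
    then have "(\<lambda>n. p n - char L t) \<longlonglongrightarrow> 0"
      by (intro Lim_null_comparison[OF always_eventually[OF allI[OF bound]]]) simp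
    then show ?thesis by (simp add: LIM_zero_iff)
  qed
  show "char M t = char N t"
    by (rule LIMSEQ_unique[OF lim[OF assms(1) bM] lim[OF assms(2) bN mom]]) simp
qed

text \<open>The transform at \<open>r = sqrt k\<close> is the \<open>k\<close>-th moment of \<open>exp (- x\<^sup>2)\<close>, a variable with values in
  \<open>[0, 1]\<close>. Its law is therefore determined, and so is that of \<open>\<bar>x\<bar>\<close>, a function of it. For a
  symmetric law the characteristic function is \<open>E cos (t \<bar>x\<bar>)\<close>.\<close>

lemma symmetric_law_eqI:
  assumes "real_distribution M" "real_distribution N"
    and symM: "distr M borel uminus = M" and symN: "distr N borel uminus = N"
    and gt: "\<And>r. r > 0 \<Longrightarrow> gauss_transform M r = gauss_transform N r"
  shows "M = N"
proof -
  interpret M: real_distribution M by fact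
  interpret N: real_distribution N by fact
  define y :: "real \<Rightarrow> real" where "y x = exp (- x\<^sup>2)" for x
  have [measurable]: "y \<in> borel_measurable borel" by (simp add: y_def[abs_def])
  have laws: "distr M borel y = distr N borel y"
  proof (rule bounded_law_eq_if_moments_eq)
    fix k :: nat
    have pow: "y x ^ k = exp (- ((sqrt k)\<^sup>2 * x\<^sup>2))" for x
      by (simp add: y_def exp_of_nat_mult[symmetric])
    have "(\<integral>x. y x ^ k \<partial>M) = (\<integral>x. y x ^ k \<partial>N)"
    proof (cases "k = 0")
      case False
      then show ?thesis using gt[of "sqrt k"] by (simp add: pow gauss_transform_def)
    qed (use M.prob_space N.prob_space in simp)
    then show "(\<integral>x. x ^ k \<partial>distr M borel y) = (\<integral>x. x ^ k \<partial>distr N borel y)"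
      by (simp add: integral_distr)
  qed (auto intro!: M.real_distribution_distr N.real_distribution_distr simp: AE_distr_iff y_def)
  have abs: "distr L borel abs = distr (distr L borel y) borel (\<lambda>z. sqrt (- ln z))"
    if "sets L = sets borel" for L :: "real measure"
  proof -
    have [measurable_cong]: "sets L = sets borel" by fact
    show ?thesis by (subst distr_distr) (auto simp: comp_def y_def intro!: distr_cong)
  qed
  have absMN: "distr M borel abs = distr N borel abs"
    by (simp add: abs laws)
  have char_abs: "char L t = (\<integral>x. cos (t * x) \<partial>distr L borel abs)"
    if L: "real_distribution L" and sym: "distr L borel uminus = L" for L t
  proof -
    interpret L: real_distribution L by fact
    have "(\<integral>x. sin (t * x) \<partial>L) = (\<integral>x. sin (t * x) \<partial>distr L borel uminus)" by (simp add: sym)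
    also have "\<dots> = - (\<integral>x. sin (t * x) \<partial>L)" by (subst integral_distr) auto
    finally have s: "(\<integral>x. sin (t * x) \<partial>L) = 0" by simp
    have c: "cos (t * x) = cos (t * \<bar>x\<bar>)" for x by (cases "x \<ge> 0") auto
    have int: "integrable L (\<lambda>x. iexp (t * x))" by (intro L.integrable_const_bound[where B=1]) auto
    have "Im (char L t) = 0"
      using s integral_Im[OF int] by (simp add: char_def Im_exp)
    moreover have "Re (char L t) = (\<integral>x. cos (t * x) \<partial>distr L borel abs)"
      using integral_Re[OF int] by (simp add: char_def integral_distr c[symmetric] Re_exp)
    ultimately show ?thesis by (simp add: complex_eq_iff)
  qed
  show ?thesis
    by (rule Levy_uniqueness) (use assms in \<open>auto simp: char_abs absMN\<close>)
qed

section \<open>The integral equation\<close>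

text \<open>With \<open>G r = r * K r\<close> the equation gives \<open>G' = K ^ 3 = G ^ 3 / r ^ 3\<close>. Separating variables,
  \<open>1 / G\<^sup>2 - 1 / r\<^sup>2\<close> is constant; the bound \<open>K \<le> 1\<close> makes the constant nonnegative.\<close>

lemma averaged_cube_equation:
  fixes K :: "real \<Rightarrow> real"
  assumes cont: "\<And>r. isCont K r"
    and pos: "\<And>r. K r > 0" and le1: "\<And>r. K r \<le> 1"
    and eq: "\<And>r. r > 0 \<Longrightarrow> r * K r = integral {0..r} (\<lambda>s. K s ^ 3)"
  shows "\<exists>c\<ge>0. \<forall>r>0. K r = 1 / sqrt (1 + c * r\<^sup>2)"
proof -
  define G where "G r = r * K r" for r
  have Gpos: "G r > 0" if "r > 0" for r using that pos by (simp add: G_def)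
  have derG: "(G has_real_derivative K r ^ 3) (at r)" if r: "r > 0" for r
  proof -
    have "continuous_on {0..r+1} (\<lambda>s. K s ^ 3)"
      by (intro continuous_intros continuous_at_imp_continuous_on ballI cont)
    then have "((\<lambda>u. integral {0..u} (\<lambda>s. K s ^ 3)) has_real_derivative K r ^ 3) (at r within {0..r+1})"
      by (rule integral_has_real_derivative) (use r in auto)
    then have "((\<lambda>u. integral {0..u} (\<lambda>s. K s ^ 3)) has_real_derivative K r ^ 3) (at r)"
      using r by (subst (asm) at_within_interior) auto
    moreover have "\<forall>\<^sub>F u in nhds r. integral {0..u} (\<lambda>s. K s ^ 3) = G u"
      using r by (intro eventually_mono[OF eventually_nhds_in_open[of "{0<..}"]]) (auto simp: eq G_def)
    ultimately show ?thesis by (subst (asm) DERIV_cong_ev[OF refl _ refl])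
  qed
  define Q where "Q r = 1 / (G r)\<^sup>2 - 1 / r\<^sup>2" for r
  have "(Q has_real_derivative 0) (at r within {0<..})" if "r \<in> {0<..}" for r
  proof -
    from that have r: "r > 0" by simp
    have g: "G r > 0" using r by (rule Gpos)
    have "((\<lambda>r. 1 / (G r)\<^sup>2) has_real_derivative - (2 * K r ^ 3 / G r ^ 3)) (at r)"
      using g by (auto intro!: derivative_eq_intros derG[OF r] simp: field_simps eval_nat_numeral)
    moreover have "((\<lambda>r. 1 / r\<^sup>2) has_real_derivative - (2 / r ^ 3)) (at r)"
      using r by (auto intro!: derivative_eq_intros simp: field_simps eval_nat_numeral)
    ultimately have "(Q has_real_derivative - (2 * K r ^ 3 / G r ^ 3) - - (2 / r ^ 3)) (at r)"
      unfolding Q_def[abs_def] by (rule DERIV_diff)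
    moreover have "- (2 * K r ^ 3 / G r ^ 3) - - (2 / r ^ 3) = 0"
      using r pos[of r] by (simp add: G_def power_mult_distrib)
    ultimately show ?thesis by (simp add: has_field_derivative_at_within)
  qed
  then obtain c where c: "\<And>r. r > 0 \<Longrightarrow> Q r = c"
    using has_field_derivative_zero_constant[of "{0<..}" Q] by auto
  have "c \<ge> 0"
    using c[of 1] pos[of 1] le1[of 1] by (auto simp: Q_def G_def power_le_one)
  moreover have "K r = 1 / sqrt (1 + c * r\<^sup>2)" if r: "r > 0" for r
  proof -
    have "1 + c * r\<^sup>2 = (1 / K r)\<^sup>2"
      unfolding c[OF r, symmetric] Q_def G_def using r pos[of r]
      by (simp add: power_divide power_mult_distrib algebra_simps)
    then have "sqrt (1 + c * r\<^sup>2) = 1 / K r" using pos[of r] by (simp add: real_sqrt_divide)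
    then show ?thesis by simp
  qed
  ultimately show ?thesis by blast
qed

text \<open>The integrand is the derivative of \<open>s / sqrt (1 + c * s\<^sup>2)\<close>.\<close>

lemma integral_cubed_profile:
  fixes c r :: real
  assumes "c \<ge> 0" "r \<ge> 0"
  shows "integral {0..r} (\<lambda>s. (1 / sqrt (1 + c * s\<^sup>2)) ^ 3) = r * (1 / sqrt (1 + c * r\<^sup>2))"
proof -
  have "((\<lambda>s. (1 / sqrt (1 + c * s\<^sup>2)) ^ 3) has_integral
      r / sqrt (1 + c * r\<^sup>2) - 0 / sqrt (1 + c * 0\<^sup>2)) {0..r}"
  proof (rule fundamental_theorem_of_calculus[OF assms(2)])
    fix s :: real
    define w where "w = sqrt (1 + c * s\<^sup>2)"
    have g: "1 + c * s\<^sup>2 > 0" using assms by (simp add: add_pos_nonneg)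
    have w: "w > 0" "w\<^sup>2 = 1 + c * s\<^sup>2" using g by (auto simp: w_def)
    have "((\<lambda>s. s / sqrt (1 + c * s\<^sup>2)) has_real_derivative
        (w - s * (c * (2 * s) * (inverse w / 2))) / (w * w)) (at s)"
      unfolding w_def using g by (auto intro!: derivative_eq_intros)
    moreover have "(w - s * (c * (2 * s) * (inverse w / 2))) / (w * w) = (1 / w) ^ 3"
      using w by (simp add: field_simps power2_eq_square power3_eq_cube)
    ultimately show "((\<lambda>s. s / sqrt (1 + c * s\<^sup>2)) has_vector_derivative
        (1 / sqrt (1 + c * s\<^sup>2)) ^ 3) (at s within {0..r})"
      unfolding w_def[symmetric]
      by (simp add: has_field_derivative_at_within has_real_derivative_iff_has_vector_derivative[symmetric])
  qed
  then show ?thesis by (simp add: integral_unique)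
qed

section \<open>Centred Gaussian laws\<close>

lemma real_distribution_gaussian_law: "real_distribution (gaussian_law 0 s)" if "s \<ge> 0"
proof (cases "s = 0")
  case True
  then show ?thesis
    by (auto simp: gaussian_law_def real_distribution_def real_distribution_axioms_def intro!: prob_space_return)
next
  case False
  then show ?thesis using that
    by (auto simp: gaussian_law_def real_distribution_def real_distribution_axioms_def intro!: prob_space_normal_density)
qed

text \<open>The kernel times the density with standard deviation \<open>s\<close> is again a centred Gaussian density up to
  the factor \<open>1 / w\<close>, with \<open>w = sqrt (1 + 2 s\<^sup>2 r\<^sup>2)\<close> and standard deviation \<open>s / w\<close>.\<close>

lemma gauss_transform_gaussian_law:
  assumes "s \<ge> 0"
  shows "gauss_transform (gaussian_law 0 s) r = 1 / sqrt (1 + 2 * s\<^sup>2 * r\<^sup>2)"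
proof (cases "s = 0")
  case True
  then show ?thesis by (simp add: gaussian_law_def gauss_transform_def integral_return)
next
  case False
  with assms have s: "s > 0" by simp
  define w where "w = sqrt (1 + 2 * s\<^sup>2 * r\<^sup>2)"
  have "1 + 2 * s\<^sup>2 * r\<^sup>2 > 0" by (simp add: add_pos_nonneg)
  then have w: "w > 0" "w\<^sup>2 = 1 + 2 * s\<^sup>2 * r\<^sup>2" by (auto simp: w_def)
  have key: "normal_density 0 s x * exp (- (r\<^sup>2 * x\<^sup>2)) = (1 / w) * normal_density 0 (s / w) x" for x
  proof -
    have "- x\<^sup>2 / (2 * s\<^sup>2) + - (r\<^sup>2 * x\<^sup>2) = - x\<^sup>2 / (2 * (s / w)\<^sup>2)"
      using s w by (simp add: power_divide field_simps)
    moreover have "sqrt (2 * pi * (s / w)\<^sup>2) = sqrt (2 * pi * s\<^sup>2) / w"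
      using s w by (simp add: real_sqrt_mult real_sqrt_divide)
    ultimately show ?thesis
      using w by (simp add: normal_density_def mult_exp_exp[symmetric] exp_add[symmetric])
  qed
  have "gauss_transform (gaussian_law 0 s) r = (\<integral>x. normal_density 0 s x * exp (- (r\<^sup>2 * x\<^sup>2)) \<partial>lborel)"
    using s by (simp add: gauss_transform_def gaussian_law_def integral_density)
  also have "\<dots> = 1 / w" using s w by (simp add: key)
  finally show ?thesis by (simp add: w_def)
qed

lemma gaussian_law_symmetric:
  assumes "s \<ge> 0"
  shows "distr (gaussian_law 0 s) borel uminus = gaussian_law 0 s"
proof (cases "s = 0")
  case True
  then show ?thesis by (simp add: gaussian_law_def distr_return)
next
  case False
  have "density lborel (\<lambda>x. ennreal (normal_density 0 s x)) =
     density (distr lborel borel uminus) (\<lambda>x. ennreal (normal_density 0 s x))"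
    by (simp add: lborel_distr_uminus)
  also have "\<dots> = distr (density lborel (\<lambda>x. ennreal (normal_density 0 s (- x)))) borel uminus"
    by (subst density_distr) auto
  finally show ?thesis using False by (simp add: gaussian_law_def normal_density_def)
qed

section \<open>The norm of the vector scaled by a uniform variable\<close>

lemma integral_uniform_even:
  fixes f :: "real \<Rightarrow> real"
  assumes cont: "\<And>x. isCont f x" and even: "\<And>x. f (- x) = f x"
  shows "(\<integral>x. f x \<partial>uniform_measure lborel {-1<..<1}) = integral {0..1} f"
proof -
  have cf: "continuous_on A f" for A by (simp add: cont continuous_at_imp_continuous_on)
  have [measurable]: "f \<in> borel_measurable borel" by (intro borel_measurable_continuous_onI cf)
  have int: "set_integrable lborel {-1<..<1} f"
    by (rule set_integrable_subset[of lborel "{-1..1}"])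
      (use borel_integrable_compact[OF compact_Icc cf] in \<open>auto simp: set_integrable_def\<close>)
  have "uniform_measure lborel {-1<..<1::real} = density lborel (\<lambda>x. ennreal (indicator {-1<..<1} x / 2))"
    unfolding uniform_measure_def
    by (intro density_cong) (auto simp: divide_ennreal[symmetric] split: split_indicator)
  then have "(\<integral>x. f x \<partial>uniform_measure lborel {-1<..<1}) = (\<integral>x. indicator {-1<..<1} x / 2 * f x \<partial>lborel)"
    by (simp add: integral_density)
  also have "\<dots> = (LINT x:{-1<..<1}|lborel. f x) / 2"
    by (simp add: set_lebesgue_integral_def)
  also have "\<dots> = integral {-1..1} f / 2"
    using set_borel_integral_eq_integral(2)[OF int] by (simp add: integral_open_interval_real)
  also have "integral {-1..1} f = integral {-1..0} f + integral {0..1} f"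
    by (intro Henstock_Kurzweil_Integration.integral_combine[symmetric] integrable_continuous_real cf) auto
  also have "integral {-1..0} f = integral {0..1} f"
    using Henstock_Kurzweil_Integration.integral_reflect_real[of 1 0 f] by (simp add: even)
  finally show ?thesis by simp
qed

context prob_space
begin

text \<open>This makes Fubini's theorem available for functions of the two variables.\<close>

lemma distr_pair_indep_random_variables:
  assumes "indep_random_variables M S Y T Z"
  shows "distr M (S \<Otimes>\<^sub>M T) (\<lambda>\<omega>. (Y \<omega>, Z \<omega>)) = distr M S Y \<Otimes>\<^sub>M distr M T Z"
proof (rule sym, rule pair_measure_eqI)
  have rv [measurable]: "Y \<in> measurable M S" "Z \<in> measurable M T"
    and ind: "indep_set {Y -` A \<inter> space M | A. A \<in> sets S} {Z -` B \<inter> space M | B. B \<in> sets T}"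
    using assms by (auto simp: indep_random_variables_def)
  show "sigma_finite_measure (distr M S Y)" "sigma_finite_measure (distr M T Z)"
    by (auto intro!: prob_space_imp_sigma_finite prob_space_distr rv)
  fix A B assume AB: "A \<in> sets (distr M S Y)" "B \<in> sets (distr M T Z)"
  then have m: "prob ((Y -` A \<inter> space M) \<inter> (Z -` B \<inter> space M))
      = prob (Y -` A \<inter> space M) * prob (Z -` B \<inter> space M)"
    by (intro indep_setD[OF ind]) auto
  have "(\<lambda>\<omega>. (Y \<omega>, Z \<omega>)) -` (A \<times> B) \<inter> space M = (Y -` A \<inter> space M) \<inter> (Z -` B \<inter> space M)" by auto
  then show "emeasure (distr M S Y) A * emeasure (distr M T Z) B =
      emeasure (distr M (S \<Otimes>\<^sub>M T) (\<lambda>\<omega>. (Y \<omega>, Z \<omega>))) (A \<times> B)"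
    using AB by (simp add: emeasure_distr emeasure_eq_measure m ennreal_mult)
qed simp

text \<open>The kernel \<open>exp (- r\<^sup>2 |x|\<^sup>2)\<close> is a product over the coordinates.\<close>

lemma gauss_transform_iid_norm:
  fixes X :: "'a \<Rightarrow> real ^ 3"
  assumes ind: "indep_vars (\<lambda>_. borel) (\<lambda>i \<omega>. X \<omega> $ i) UNIV"
    and id: "\<And>i. distr M borel (\<lambda>\<omega>. X \<omega> $ i) = \<mu>"
    and [measurable]: "X \<in> borel_measurable M"
  shows "(\<integral>x. exp (- (r\<^sup>2 * ((x $ 1)\<^sup>2 + (x $ 2)\<^sup>2 + (x $ 3)\<^sup>2))) \<partial>distr M borel X) = gauss_transform \<mu> r ^ 3"
proof -
  have comp [measurable]: "(\<lambda>\<omega>. X \<omega> $ i) \<in> borel_measurable M" for i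
    using ind by (auto simp: indep_vars_def)
  have ind': "indep_vars (\<lambda>_. borel) (\<lambda>i \<omega>. exp (- (r\<^sup>2 * (X \<omega> $ i)\<^sup>2))) UNIV"
    by (rule indep_vars_compose2[OF ind]) auto
  have int: "integrable M (\<lambda>\<omega>. exp (- (r\<^sup>2 * (X \<omega> $ i)\<^sup>2)))" for i
    by (rule integrable_const_bound[where B = 1]) (auto intro!: mult_nonneg_nonneg)
  have each: "(\<integral>\<omega>. exp (- (r\<^sup>2 * (X \<omega> $ i)\<^sup>2)) \<partial>M) = gauss_transform \<mu> r" for i
    unfolding gauss_transform_def id[of i, symmetric] by (subst integral_distr) auto
  have prod: "exp (- (r\<^sup>2 * ((x $ 1)\<^sup>2 + (x $ 2)\<^sup>2 + (x $ 3)\<^sup>2)))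
      = (\<Prod>i\<in>UNIV. exp (- (r\<^sup>2 * (x $ i)\<^sup>2)))" for x :: "real ^ 3"
    by (subst exp_sum[symmetric], simp, simp only: sum_3, simp add: distrib_left)
  have "(\<integral>x. exp (- (r\<^sup>2 * ((x $ 1)\<^sup>2 + (x $ 2)\<^sup>2 + (x $ 3)\<^sup>2))) \<partial>distr M borel X)
     = (\<integral>\<omega>. (\<Prod>i\<in>UNIV. exp (- (r\<^sup>2 * (X \<omega> $ i)\<^sup>2))) \<partial>M)"
    by (subst integral_distr) (simp_all add: prod)
  also have "\<dots> = (\<Prod>i\<in>(UNIV::3 set). \<integral>\<omega>. exp (- (r\<^sup>2 * (X \<omega> $ i)\<^sup>2)) \<partial>M)"
    by (intro indep_vars_lebesgue_integral ind' int) auto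
  finally show ?thesis by (simp add: each)
qed

text \<open>Negating \<open>v\<close> preserves the joint law of \<open>V\<close> and \<open>X\<close> and negates \<open>W\<close>, whence the symmetry. For the
  transform, integrating over \<open>x\<close> first leaves the cube at \<open>r * v\<close>; this is even in \<open>v\<close>, so the mean over
  \<open>(-1, 1)\<close> is the integral over \<open>[0, 1]\<close>, which is then rescaled to \<open>[0, r]\<close>.\<close>

lemma law_of_uniform_scale:
  fixes X :: "'a \<Rightarrow> real ^ 3" and V :: "'a \<Rightarrow> real"
  defines "W \<equiv> (\<lambda>\<omega>. V \<omega> * sqrt ((X \<omega> $ 1)\<^sup>2 + (X \<omega> $ 2)\<^sup>2 + (X \<omega> $ 3)\<^sup>2))"
  assumes indX: "indep_vars (\<lambda>_. borel) (\<lambda>i \<omega>. X \<omega> $ i) UNIV"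
    and id: "\<And>i. distr M borel (\<lambda>\<omega>. X \<omega> $ i) = \<mu>"
    and unif: "distr M borel V = uniform_measure lborel {-1<..<1}"
    and indV: "indep_random_variables M borel V borel X"
  shows real_distribution_uniform_scale: "real_distribution (distr M borel W)"
    and uniform_scale_symmetric: "distr (distr M borel W) borel uminus = distr M borel W"
    and gauss_transform_uniform_scale:
      "r > 0 \<Longrightarrow> r * gauss_transform (distr M borel W) r = integral {0..r} (\<lambda>s. gauss_transform \<mu> s ^ 3)"
proof -
  have rvs [measurable]: "V \<in> borel_measurable M" "X \<in> borel_measurable M"
    using indV by (auto simp: indep_random_variables_def)
  define q :: "real ^ 3 \<Rightarrow> real" where "q x = (x $ 1)\<^sup>2 + (x $ 2)\<^sup>2 + (x $ 3)\<^sup>2" for x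
  have q_nonneg: "q x \<ge> 0" for x by (simp add: q_def)
  have [measurable]: "q \<in> borel_measurable borel" unfolding q_def[abs_def] by measurable
  define w where "w = (\<lambda>(v, x). v * sqrt (q x))"
  have [measurable]: "w \<in> borel_measurable (borel \<Otimes>\<^sub>M borel)" unfolding w_def by measurable
  have W: "W = (\<lambda>\<omega>. w (V \<omega>, X \<omega>))" by (simp add: W_def w_def q_def)
  have [measurable]: "W \<in> borel_measurable M" unfolding W by measurable
  let ?U = "uniform_measure lborel {-1<..<1::real}" and ?P = "distr M borel X"
  interpret P: prob_space ?P by (rule prob_space_distr) simp
  interpret U: prob_space ?U unfolding unif[symmetric] by (rule prob_space_distr) simp
  interpret PU: pair_prob_space ?U ?P ..
  have joint: "distr M (borel \<Otimes>\<^sub>M borel) (\<lambda>\<omega>. (V \<omega>, X \<omega>)) = ?U \<Otimes>\<^sub>M ?P"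
    using distr_pair_indep_random_variables[OF indV] by (simp add: unif)
  have lawW: "distr M borel W = distr (?U \<Otimes>\<^sub>M ?P) borel w"
    unfolding joint[symmetric] by (subst distr_distr) (auto simp: W comp_def)
  show "real_distribution (distr M borel W)" by (intro real_distribution_distr) simp
  have "(\<lambda>\<omega>. X \<omega> $ 1) \<in> borel_measurable M"
    using indX by (auto simp: indep_vars_def)
  then interpret \<mu>: real_distribution \<mu>
    unfolding id[of 1, symmetric] by (rule real_distribution_distr)

  have "distr ?U borel uminus = ?U"
  proof (rule measure_eqI)
    fix A assume "A \<in> sets (distr ?U borel uminus)"
    then have A [measurable]: "A \<in> sets borel" by simp
    have "emeasure lborel ({-1<..<1} \<inter> A) = emeasure (distr lborel borel uminus) ({-1<..<1} \<inter> A)"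
      by (simp add: lborel_distr_uminus)
    also have "\<dots> = emeasure lborel ({-1<..<1} \<inter> uminus -` A)"
      by (subst emeasure_distr) (auto intro!: arg_cong2[where f = emeasure])
    finally show "emeasure (distr ?U borel uminus) A = emeasure ?U A"
      by (simp add: emeasure_distr measurable_sets_borel[of uminus borel])
  qed simp
  moreover have "distr ?U borel uminus \<Otimes>\<^sub>M distr ?P borel (\<lambda>x. x) =
      distr (?U \<Otimes>\<^sub>M ?P) (borel \<Otimes>\<^sub>M borel) (\<lambda>(v, x). (- v, x))"
    by (rule pair_measure_distr) (auto intro!: prob_space_imp_sigma_finite P.prob_space_distr)
  moreover have "distr ?P borel (\<lambda>x. x) = ?P" by (rule distr_id2) simp
  ultimately have flip: "distr (?U \<Otimes>\<^sub>M ?P) (borel \<Otimes>\<^sub>M borel) (\<lambda>(v, x). (- v, x)) = ?U \<Otimes>\<^sub>M ?P" by simp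
  have "distr (distr M borel W) borel uminus
      = distr (distr (?U \<Otimes>\<^sub>M ?P) (borel \<Otimes>\<^sub>M borel) (\<lambda>(v, x). (- v, x))) borel w"
    unfolding lawW by (subst (1 2) distr_distr) (auto simp: comp_def w_def case_prod_beta intro!: distr_cong)
  then show "distr (distr M borel W) borel uminus = distr M borel W"
    by (simp add: flip lawW)

  show "r * gauss_transform (distr M borel W) r = integral {0..r} (\<lambda>s. gauss_transform \<mu> s ^ 3)" if r: "r > 0"
  proof -
    have bnd: "integrable (?U \<Otimes>\<^sub>M ?P) (\<lambda>(v, x). exp (- ((r * v)\<^sup>2 * q x)))"
      by (intro PU.P.integrable_const_bound[where B = 1]) (auto intro!: mult_nonneg_nonneg simp: q_nonneg case_prod_beta)
    have sq: "(r\<^sup>2 * (w (v, x))\<^sup>2) = (r * v)\<^sup>2 * q x" for v x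
      by (simp add: w_def power_mult_distrib q_nonneg)
    have "gauss_transform (distr M borel W) r = (\<integral>z. exp (- (r\<^sup>2 * (w z)\<^sup>2)) \<partial>(?U \<Otimes>\<^sub>M ?P))"
      unfolding gauss_transform_def lawW by (subst integral_distr) auto
    also have "\<dots> = (\<integral>(v, x). exp (- ((r * v)\<^sup>2 * q x)) \<partial>(?U \<Otimes>\<^sub>M ?P))"
      by (intro Bochner_Integration.integral_cong) (auto simp: sq)
    also have "\<dots> = (\<integral>v. (\<integral>x. exp (- ((r * v)\<^sup>2 * q x)) \<partial>?P) \<partial>?U)"
      by (rule PU.integral_fst'[symmetric, OF bnd, simplified])
    also have "\<dots> = (\<integral>v. gauss_transform \<mu> (r * v) ^ 3 \<partial>?U)"
      by (simp only: q_def gauss_transform_iid_norm[OF indX id rvs(2)])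
    also have "\<dots> = integral {0..1} (\<lambda>v. gauss_transform \<mu> (r * v) ^ 3)"
      by (rule integral_uniform_even)
         (auto intro!: continuous_intros isCont_o2[OF _ \<mu>.isCont_gauss_transform] simp: gauss_transform_even)
    finally have "gauss_transform (distr M borel W) r = integral {0..1} (\<lambda>v. gauss_transform \<mu> (r * v) ^ 3)" .
    moreover have "integral {0..1} (\<lambda>v. gauss_transform \<mu> (r * v) ^ 3) = integral {0..r} (\<lambda>s. gauss_transform \<mu> s ^ 3) / r"
      using integral_stretch_real[of r 0 r "\<lambda>s. gauss_transform \<mu> s ^ 3"] r by simp
    ultimately show ?thesis using r by simp
  qed
qed

end

section \<open>The characterization of the centred Gaussian laws\<close>

theorem proposition1p3:
  fixes M :: "'a measure"
    and X :: "'a \<Rightarrow> real ^ 3"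
    and V :: "'a \<Rightarrow> real"
  assumes "prob_space M"
    and "prob_space.indep_vars M (\<lambda>_. borel) (\<lambda>i \<omega>. X \<omega> $ i) UNIV"
    and "\<And>i j. distr M borel (\<lambda>\<omega>. X \<omega> $ i) = distr M borel (\<lambda>\<omega>. X \<omega> $ j)"
    and "distr M borel V = uniform_measure lborel {-1<..<1}"
    and "indep_random_variables M borel V borel X"
  shows "mean_zero_gaussian (distr M borel (\<lambda>\<omega>. X \<omega> $ 1)) \<longleftrightarrow>
    distr M borel (\<lambda>\<omega>. X \<omega> $ 1) =
    distr M borel (\<lambda>\<omega>. V \<omega> * sqrt ((X \<omega> $ 1)\<^sup>2 + (X \<omega> $ 2)\<^sup>2 + (X \<omega> $ 3)\<^sup>2))"
proof -
  interpret prob_space M by fact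
  define \<mu> where "\<mu> = distr M borel (\<lambda>\<omega>. X \<omega> $ 1)"
  define \<nu> where "\<nu> = distr M borel (\<lambda>\<omega>. V \<omega> * sqrt ((X \<omega> $ 1)\<^sup>2 + (X \<omega> $ 2)\<^sup>2 + (X \<omega> $ 3)\<^sup>2))"
  have id: "distr M borel (\<lambda>\<omega>. X \<omega> $ i) = \<mu>" for i
    unfolding \<mu>_def by (rule assms(3))
  note scale = law_of_uniform_scale[OF assms(2) id assms(4,5), folded \<nu>_def]
  have "(\<lambda>\<omega>. X \<omega> $ 1) \<in> borel_measurable M"
    using assms(2) by (auto simp: indep_vars_def)
  then interpret \<mu>: real_distribution \<mu> unfolding \<mu>_def by (rule real_distribution_distr)
  have "mean_zero_gaussian \<mu> \<longleftrightarrow> \<mu> = \<nu>"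
  proof
    assume "mean_zero_gaussian \<mu>"
    then obtain s where s: "s \<ge> 0" and \<mu>: "\<mu> = gaussian_law 0 s"
      by (auto simp: mean_zero_gaussian_def)
    show "\<mu> = \<nu>"
    proof (rule symmetric_law_eqI[OF \<mu>.real_distribution_axioms scale(1) _ scale(2)])
      show "distr \<mu> borel uminus = \<mu>" unfolding \<mu> by (rule gaussian_law_symmetric[OF s])
      fix r :: real assume r: "r > 0"
      have "r * gauss_transform \<nu> r = r * gauss_transform \<mu> r"
        unfolding scale(3)[OF r] \<mu> gauss_transform_gaussian_law[OF s]
        by (rule integral_cubed_profile) (use r in auto)
      then show "gauss_transform \<mu> r = gauss_transform \<nu> r" using r by simp
    qed
  next
    assume eq: "\<mu> = \<nu>"
    obtain c where c: "c \<ge> 0" "\<And>r. r > 0 \<Longrightarrow> gauss_transform \<mu> r = 1 / sqrt (1 + c * r\<^sup>2)"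
      using averaged_cube_equation[OF \<mu>.isCont_gauss_transform \<mu>.gauss_transform_pos \<mu>.gauss_transform_le_1]
        scale(3)[folded eq] by blast
    \<comment> \<open>The transform of the Gaussian law has constant \<open>2 s\<^sup>2\<close> in place of \<open>c\<close>, hence \<open>s = sqrt (c / 2)\<close>.\<close>
    have "\<mu> = gaussian_law 0 (sqrt (c / 2))"
    proof (rule symmetric_law_eqI[OF \<mu>.real_distribution_axioms])
      show "distr \<mu> borel uminus = \<mu>" using scale(2) by (simp add: eq)
    qed (use c in \<open>auto intro!: real_distribution_gaussian_law gaussian_law_symmetric
        simp: gauss_transform_gaussian_law\<close>)
    then show "mean_zero_gaussian \<mu>"
      unfolding mean_zero_gaussian_def using c(1) by (intro exI[of _ "sqrt (c / 2)"]) simp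
  qed
  then show ?thesis by (simp only: \<mu>_def \<nu>_def)
qed

end
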